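(* Let $M,N\subset\mathbb{R}^n$ be $C^1$ embedded submanifolds through $x$, of respective dimensions $p$ and $q$. Assume that $M\cap N$ is locally a $C^1$ embedded submanifold near $x$ and that the intersection is clean: \[ T_x(M\cap N)=T_xM\cap T_xN. \] Then \[ \dim_{\times}\{x\}_{M\cup N}=\dim\bigl(T_xM+T_xN\bigr) \quad\text{and}\quad \dim_{\times}\{x\}_{M\cap N}=\dim\bigl(T_xM\cap T_xN\bigr). \] Consequently, \[ \dim_{\times}\{x\}_{M\cup N}+\dim_{\times}\{x\}_{M\cap N}=p+q. \] In particular, if $M$ and $N$ are transverse at $x$, so that $T_xM+T_xN=\mathbb{R}^n$, then \[ \dim_{\times}\{x\}_{M\cup N}=n\quad\text{and}\quad\dim_{\times}\{x\}_{M\cap N}=p+q-n. \] If instead $T_xM\cap T_xN=\{0\}$, then \[ \dim_{\times}\{x\}_{M\cup N}=p+q,\qquad\dim_{\times}\{x\}_{M\cap N}=0. \]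
   Context: Submanifolds are without boundary. Tangent cone: for $A\subset\mathbb{R}^n$, $\mathrm{Tan}_x(A)$ is the set of $v\in\mathbb{R}^n$ for which there exist $x_k\in A$, $x_k\to x$, and positive reals $\lambda_k\downarrow0$ with $(x_k-x)/\lambda_k\to v$. Effective directions: $\mathrm{Eff}_x(A):=\mathrm{Tan}_x(A)\cap S^{n-1}$ if $x\in\overline A$ (and $\varnothing$ otherwise). For $v\ne0$ let $[v]=\mathbb{R}v\in\mathbb{P}^{n-1}$; $\mathrm{Eff}_x^{\mathbb P}(A):=\{[v]:v\in\mathrm{Eff}_x(A)\}$. Admissible probes: for $x\in\overline A$, $v\in S^{n-1}$, $\mathcal G_x^A(v)$ is the family of all injective Lipschitz maps $\gamma:[0,\delta]\to\mathbb{R}^n$ (some $\delta>0$) with $\gamma(0)=x$, $\lim_{t\to0^+}\frac{\gamma(t)-x}{\|\gamma(t)-x\|}=v$, and $A\cap\gamma((0,\eta])\ne\varnothing$ for every $\eta\in(0,\delta]$; $\Gamma_\gamma:=\gamma([0,\delta])$. Point-extended box dimension: for bounded $E$, $N_\varepsilon(E)$ is the minimal number of sets of diameter at most $\varepsilon$ covering $E$ and $\overline{\dim}_B(E):=\limsup_{\varepsilon\to0}\frac{\ln N_\varepsilon(E)}{\ln(1/\varepsilon)}$. For $x\in\overline E$, $\dim_{\mathrm{Pbox}}\{x\}_E:=\inf_{r>0}\overline{\dim}_B(E\cap B(x,r))$; it is $0$ if $x\notin\overline E$. Directional contribution: for $v\in\mathrm{Eff}_x(A)$, $\theta_x^A(v):=\sup_{\gamma\in\mathcal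 G_x^A(v)}\dim_{\mathrm{Pbox}}\{x\}_{A\cap\Gamma_\gamma}$; for $\xi\in\mathrm{Eff}_x^{\mathbb P}(A)$, $\theta_x^A(\xi):=\sup\{\theta_x^A(w):w\in\mathrm{Eff}_x(A),[w]=\xi\}$. Point-Cross dimension at $x\in\overline A$: $\dim_\times\{x\}_A:=\sup\sum_{i=1}^m\theta_x^A(\xi_i)$ over all $m\in\{0,\dots,n\}$ and all $\xi_1,\dots,\xi_m\in\mathrm{Eff}_x^{\mathbb P}(A)$ that are projectively (linearly) independent, i.e. nonzero representatives are linearly independent (empty family allowed, with sum $0$). *)

theory Defs
  imports "HOL-Analysis.Analysis"
begin

text \<open>Throughout, \<open>\<real>\<^sup>n\<close> is an arbitrary Euclidean space \<open>'a\<close> with \<open>n = DIM('a) \<ge> 1\<close>.\<close>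

section \<open>Embedded \<open>C\<^sup>1\<close> submanifolds and their tangent spaces\<close>

definition C1_map_on :: "'a::euclidean_space set \<Rightarrow> ('a \<Rightarrow> 'b::euclidean_space) \<Rightarrow> bool" where
  "C1_map_on U f \<longleftrightarrow>
     (\<exists>f' :: 'a \<Rightarrow> 'a \<Rightarrow>\<^sub>L 'b.
        (\<forall>y\<in>U. (f has_derivative blinfun_apply (f' y)) (at y)) \<and> continuous_on U f')"

definition C1_diffeomorphism ::
  "'a::euclidean_space set \<Rightarrow> 'a set \<Rightarrow> ('a \<Rightarrow> 'a) \<Rightarrow> ('a \<Rightarrow> 'a) \<Rightarrow> bool" where
  "C1_diffeomorphism U V \<phi> \<psi> \<longleftrightarrow>
     open U \<and> open V \<and> homeomorphism U V \<phi> \<psi> \<and> C1_map_on U \<phi> \<and> C1_map_on V \<psi>"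

text \<open>Slice charts: locally, an ambient \<open>C\<^sup>1\<close> diffeomorphism carries \<open>M\<close> to a \<open>p\<close>-dimensional
  linear subspace. An arbitrary subspace \<open>L\<close> replaces the coordinate subspace
  \<open>\<real>\<^sup>p \<times> {0}\<close>, as \<open>'a\<close> has no ordered basis; the two differ by a linear change of coordinates.\<close>

definition C1_submanifold :: "nat \<Rightarrow> 'a::euclidean_space set \<Rightarrow> bool" where
  "C1_submanifold p M \<longleftrightarrow>
     (\<forall>y\<in>M. \<exists>U V \<phi> \<psi> L. y \<in> U \<and> C1_diffeomorphism U V \<phi> \<psi> \<and>
        subspace L \<and> dim L = p \<and> \<phi> ` (M \<inter> U) = V \<inter> L)"

text \<open>Velocities at \<open>x\<close> of \<open>C\<^sup>1\<close> curves in \<open>M\<close>; only the germ of \<open>M\<close> at \<open>x\<close> matters.\<close>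

definition tangent_space :: "'a::euclidean_space \<Rightarrow> 'a set \<Rightarrow> 'a set" where
  "tangent_space x M =
     {v. \<exists>e>0. \<exists>c :: real \<Rightarrow> 'a. c C1_differentiable_on {-e<..<e} \<and> c ` {-e<..<e} \<subseteq> M \<and>
           c 0 = x \<and> (c has_vector_derivative v) (at 0)}"

section \<open>Tangent cone, effective directions and probes\<close>

definition tangent_cone :: "'a::euclidean_space \<Rightarrow> 'a set \<Rightarrow> 'a set" where
  "tangent_cone x A =
     {v. \<exists>X l. (\<forall>k::nat. X k \<in> A) \<and> X \<longlonglongrightarrow> x \<and>
           (\<forall>k. l k > (0::real)) \<and> decseq l \<and> l \<longlonglongrightarrow> 0 \<and>
           (\<lambda>k. (X k - x) /\<^sub>R l k) \<longlonglongrightarrow> v}"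

definition Eff :: "'a::euclidean_space \<Rightarrow> 'a set \<Rightarrow> 'a set" where
  "Eff x A = (if x \<in> closure A then tangent_cone x A \<inter> sphere 0 1 else {})"

text \<open>A point \<open>[v]\<close> of projective space is the line \<open>\<real>v\<close>, i.e. \<open>span {v}\<close> for \<open>v \<noteq> 0\<close>.\<close>

definition EffP :: "'a::euclidean_space \<Rightarrow> 'a set \<Rightarrow> 'a set set" where
  "EffP x A = (\<lambda>v. span {v}) ` Eff x A"

text \<open>A probe is recorded together with the length \<open>d\<close> of its parameter interval; the values of
  \<open>g\<close> outside \<open>{0..d}\<close> are irrelevant.\<close>

definition probes :: "'a::euclidean_space \<Rightarrow> 'a set \<Rightarrow> 'a \<Rightarrow> ((real \<Rightarrow> 'a) \<times> real) set" where
  "probes x A v =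
     {(g, d). d > 0 \<and> inj_on g {0..d} \<and> (\<exists>C. C-lipschitz_on {0..d} g) \<and> g 0 = x \<and>
        ((\<lambda>t. (g t - x) /\<^sub>R norm (g t - x)) \<longlongrightarrow> v) (at_right 0) \<and>
        (\<forall>h\<in>{0<..d}. A \<inter> g ` {0<..h} \<noteq> {})}"

section \<open>Box dimension\<close>

text \<open>Boundedness of the covering sets is explicit since \<^const>\<open>diameter\<close> is unspecified on
  unbounded sets.\<close>

definition covering_number :: "'a::metric_space set \<Rightarrow> real \<Rightarrow> nat" where
  "covering_number E \<epsilon> =
     (LEAST k. \<exists>F. finite F \<and> card F = k \<and> E \<subseteq> \<Union>F \<and> (\<forall>S\<in>F. bounded S \<and> diameter S \<le> \<epsilon>))"

definition upper_box_dim :: "'a::metric_space set \<Rightarrow> ereal" where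
  "upper_box_dim E =
     Limsup (at_right 0) (\<lambda>\<epsilon>. ereal (ln (real (covering_number E \<epsilon>)) / ln (1 / \<epsilon>)))"

definition dim_Pbox :: "'a::euclidean_space \<Rightarrow> 'a set \<Rightarrow> ereal" where
  "dim_Pbox x E =
     (if x \<in> closure E then INF r\<in>{0<..}. upper_box_dim (E \<inter> ball x r) else 0)"

section \<open>Point-Cross dimension\<close>

definition theta :: "'a::euclidean_space \<Rightarrow> 'a set \<Rightarrow> 'a \<Rightarrow> ereal" where
  "theta x A v = (SUP (g, d)\<in>probes x A v. dim_Pbox x (A \<inter> g ` {0..d}))"

definition thetaP :: "'a::euclidean_space \<Rightarrow> 'a set \<Rightarrow> 'a set \<Rightarrow> ereal" where
  "thetaP x A \<xi> = (SUP w\<in>{w \<in> Eff x A. span {w} = \<xi>}. theta x A w)"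

text \<open>The family is indexed by \<open>{..<m}\<close>; injectivity of the representatives makes independence of
  their image the linear independence of the family.\<close>

definition proj_independent :: "nat \<Rightarrow> (nat \<Rightarrow> 'a::euclidean_space set) \<Rightarrow> bool" where
  "proj_independent m \<xi> \<longleftrightarrow>
     (\<exists>w. (\<forall>i<m. w i \<noteq> 0 \<and> span {w i} = \<xi> i) \<and> inj_on w {..<m} \<and> independent (w ` {..<m}))"

definition dim_cross :: "'a::euclidean_space \<Rightarrow> 'a set \<Rightarrow> ereal" where
  "dim_cross x A =
     Sup {(\<Sum>i<m. thetaP x A (\<xi> i)) | m \<xi>.
            m \<le> DIM('a) \<and> (\<forall>i<m. \<xi> i \<in> EffP x A) \<and> proj_independent m \<xi>}"

end

theory Submission
  imports Defs "HOL-Real_Asymp.Real_Asymp"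
begin

text \<open>A Lipschitz curve has upper box dimension at most \<open>1\<close>, so every directional contribution is at most
  \<open>1\<close>. If \<open>v\<close> is the velocity at \<open>x\<close> of a \<open>C\<^sup>1\<close> curve in \<open>A\<close>, a short initial piece of that curve is a
  probe lying entirely in \<open>A\<close>, and a nondegenerate connected set has upper box dimension at least
  \<open>1\<close>, so \<open>v\<close> contributes exactly \<open>1\<close>. Hence, as soon as every effective direction is such a velocity,
  the Point-Cross dimension is the dimension of the linear span of the effective directions.
  For submanifolds, slice charts identify the tangent cone with the tangent space; the tangent cone
  of a union is the union of the tangent cones, and for a clean intersection the tangent cone of
  \<open>M \<inter> N\<close> is squeezed between \<open>T\<^sub>x(M \<inter> N)\<close> and \<open>T\<^sub>xM \<inter> T\<^sub>xN\<close>.\<close>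

section \<open>Box dimension of curves\<close>

text \<open>Cut \<open>{0..d}\<close> into \<open>m\<close> equal parameter pieces: the image of
  each has diameter at most \<open>C * d / m\<close>, which the choice of \<open>m\<close> keeps
  below \<epsilon>.\<close>

lemma lipschitz_curve_cover:
  fixes g :: "real \<Rightarrow> 'a::metric_space"
  assumes lip: "C-lipschitz_on {0..d} g" and "d > 0" "\<epsilon> > 0" and m: "C * d / \<epsilon> \<le> real m" "m > 0"
  obtains F where "finite F" "card F \<le> m" "g ` {0..d} \<subseteq> \<Union>F"
    "\<forall>S\<in>F. bounded S \<and> diameter S \<le> \<epsilon>"
proof
  define I where "I i = {real i * d / m .. (real i + 1) * d / m} \<inter> {0..d}" for i
  let ?F = "(\<lambda>i. g ` I i) ` {..<m}"
  have C: "C \<ge> 0" using lip lipschitz_on_nonneg by blast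
  show "finite ?F" by simp
  show "card ?F \<le> m" using card_image_le[of "{..<m}" "\<lambda>i. g ` I i"] by simp
  show "g ` {0..d} \<subseteq> \<Union>?F"
  proof
    fix y assume "y \<in> g ` {0..d}"
    then obtain t where t: "y = g t" "0 \<le> t" "t \<le> d" by auto
    have "\<exists>i<m. t \<in> I i"
    \<comment> \<open>The floor formula below would give the index \<open>m\<close> at the right
      endpoint, which therefore goes to the last piece \<open>m - 1\<close>.\<close>
    proof (cases "t = d")
      case True
      have "d \<in> I (m - 1)" using m(2) \<open>d > 0\<close> by (auto simp: I_def field_simps of_nat_diff)
      then show ?thesis using True m(2) by (intro exI[of _ "m - 1"]) auto
    next
      case False
      define i where "i = nat \<lfloor>t * m / d\<rfloor>"
      have q: "0 \<le> t * m / d" "t * m / d < m" using t False m(2) \<open>d > 0\<close> by (auto simp: field_simps)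
      have i: "real i \<le> t * m / d" "t * m / d < real i + 1"
        unfolding i_def using q(1) by (auto simp: of_nat_nat)
      have "i < m" using i(1) q(2) by simp
      moreover have "t \<in> I i" using i t m(2) \<open>d > 0\<close> by (auto simp: I_def field_simps)
      ultimately show ?thesis by blast
    qed
    then show "y \<in> \<Union>?F" using t by blast
  qed
  show "\<forall>S\<in>?F. bounded S \<and> diameter S \<le> \<epsilon>"
  proof
    fix S assume "S \<in> ?F"
    then obtain i where S: "S = g ` I i" by blast
    have le: "dist a b \<le> \<epsilon>" if ab: "a \<in> S" "b \<in> S" for a b
    proof -
      obtain s t where st: "a = g s" "b = g t" "s \<in> I i" "t \<in> I i" using ab S by auto
      have "dist s t \<le> (real i + 1) * d / m - real i * d / m"
        using st(3,4) by (auto simp: I_def dist_real_def)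
      also have "\<dots> = d / m" by (simp add: add_divide_distrib distrib_right)
      finally have "dist s t \<le> d / m" .
      then have "C * dist s t \<le> C * (d / m)" using C by (rule mult_left_mono)
      also have "\<dots> \<le> \<epsilon>" using m \<open>\<epsilon> > 0\<close> by (simp add: field_simps)
      finally have "C * dist s t \<le> \<epsilon>" .
      moreover have "s \<in> {0..d}" "t \<in> {0..d}" using st unfolding I_def by blast+
      ultimately show ?thesis
        using lipschitz_onD[OF lip, of s t] st(1,2) by simp
    qed
    then have "bounded S" unfolding bounded_two_points by blast
    moreover have "diameter S \<le> \<epsilon>"
      using le \<open>\<epsilon> > 0\<close> by (auto simp: diameter_def intro!: cSUP_least)
    ultimately show "bounded S \<and> diameter S \<le> \<epsilon>" ..
  qed
qed

lemma covering_number_lipschitz_curve_le: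
  fixes g :: "real \<Rightarrow> 'a::metric_space"
  assumes "C-lipschitz_on {0..d} g" and "d > 0" "\<epsilon> > 0" and E: "E \<subseteq> g ` {0..d}"
  shows "real (covering_number E \<epsilon>) \<le> C * d / \<epsilon> + 2"
proof -
  have "C \<ge> 0" using assms(1) lipschitz_on_nonneg by blast
  \<comment> \<open>The summand 1 keeps \<open>m\<close> positive when \<open>C = 0\<close>;
    together with the rounding error it accounts for the \<open>+ 2\<close> of the bound.\<close>
  define m where "m = nat \<lceil>C * d / \<epsilon>\<rceil> + 1"
  have "C * d / \<epsilon> \<le> real m" "m > 0" unfolding m_def by linarith+
  from lipschitz_curve_cover[OF assms(1-3) this]
  obtain F where F: "finite F" "card F \<le> m" "g ` {0..d} \<subseteq> \<Union>F"
    "\<forall>S\<in>F. bounded S \<and> diameter S \<le> \<epsilon>" .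
  have "covering_number E \<epsilon> \<le> card F"
    unfolding covering_number_def using F(1,4) subset_trans[OF E F(3)]
    by (intro Least_le exI[of _ F]) simp
  with F(2) have "real (covering_number E \<epsilon>) \<le> real m" by simp
  also have "\<dots> \<le> C * d / \<epsilon> + 2"
  proof -
    have "0 \<le> C * d / \<epsilon>" using \<open>C \<ge> 0\<close> assms(2,3) by simp
    then have "real (nat \<lceil>C * d / \<epsilon>\<rceil>) = of_int \<lceil>C * d / \<epsilon>\<rceil>" by simp
    then show ?thesis unfolding m_def by linarith
  qed
  finally show ?thesis .
qed

text \<open>\<open>LEAST\<close> is meaningful only if some finite cover exists; the cover of the
  Lipschitz curve supplies one, so the minimum is realised.\<close>

lemma covering_number_attained:
  fixes g :: "real \<Rightarrow> 'a::metric_space"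
  assumes "C-lipschitz_on {0..d} g" and "d > 0" "\<epsilon> > 0" and E: "E \<subseteq> g ` {0..d}"
  obtains F where "finite F" "card F = covering_number E \<epsilon>" "E \<subseteq> \<Union>F"
    "\<forall>S\<in>F. bounded S \<and> diameter S \<le> \<epsilon>"
proof -
  define m where "m = nat \<lceil>C * d / \<epsilon>\<rceil> + 1"
  have "C * d / \<epsilon> \<le> real m" "m > 0" unfolding m_def by linarith+
  from lipschitz_curve_cover[OF assms(1-3) this]
  have "\<exists>k F. finite F \<and> card F = k \<and> E \<subseteq> \<Union>F \<and> (\<forall>S\<in>F. bounded S \<and> diameter S \<le> \<epsilon>)"
    using E by (metis subset_trans)
  from LeastI_ex[OF this] show thesis using that unfolding covering_number_def by blast
qed

lemma upper_box_dim_lipschitz_curve_le: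
  fixes g :: "real \<Rightarrow> 'a::metric_space"
  assumes lip: "C-lipschitz_on {0..d} g" and "d > 0" and E: "E \<subseteq> g ` {0..d}"
  shows "upper_box_dim E \<le> 1"
proof -
  \<comment> \<open>Adding 1 makes the constant strictly positive even for \<open>C = 0\<close>, as
    the asymptotics of the logarithm require.\<close>
  define D where "D = C * d + 1"
  have D: "D > 0" using assms lipschitz_on_nonneg[OF lip] by (simp add: D_def add_nonneg_pos)
  have "upper_box_dim E \<le> Limsup (at_right 0) (\<lambda>\<epsilon>. ereal (ln (D / \<epsilon> + 2) / ln (1 / \<epsilon>)))"
    unfolding upper_box_dim_def
  proof (rule Limsup_mono)
    show "\<forall>\<^sub>F \<epsilon> in at_right 0. ereal (ln (real (covering_number E \<epsilon>)) / ln (1 / \<epsilon>))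
        \<le> ereal (ln (D / \<epsilon> + 2) / ln (1 / \<epsilon>))"
      using eventually_at_right_less[of "0::real"] eventually_at_right_real[of 0 1, simplified]
    proof eventually_elim
      case (elim \<epsilon>)
      have "real (covering_number E \<epsilon>) \<le> C * d / \<epsilon> + 2"
        using covering_number_lipschitz_curve_le[OF lip \<open>d > 0\<close> _ E] elim by simp
      also have "\<dots> \<le> D / \<epsilon> + 2" using elim by (simp add: D_def divide_right_mono)
      finally have le: "real (covering_number E \<epsilon>) \<le> D / \<epsilon> + 2" .
      have "D / \<epsilon> > 0" using D elim by simp
      then have "ln (real (covering_number E \<epsilon>)) \<le> ln (D / \<epsilon> + 2)"
        \<comment> \<open>An empty \<open>E\<close> has covering number 0, where
          \<open>ln 0 = 0\<close> by convention; the right side is positive since its argument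
          exceeds 2.\<close>
        using le by (cases "covering_number E \<epsilon> = 0") auto
      moreover have "ln (1 / \<epsilon>) > 0" using elim by (simp add: ln_div)
      ultimately show ?case by (simp add: divide_right_mono)
    qed
  qed
  also have "\<dots> = ereal 1"
  proof (rule lim_imp_Limsup)
    have "((\<lambda>\<epsilon>. ln (D / \<epsilon> + 2) / ln (1 / \<epsilon>)) \<longlongrightarrow> 1) (at_right 0)"
      using D by real_asymp
    then show "((\<lambda>\<epsilon>. ereal (ln (D / \<epsilon> + 2) / ln (1 / \<epsilon>))) \<longlongrightarrow> ereal 1) (at_right 0)"
      by simp
  qed simp
  finally show ?thesis by (simp add: one_ereal_def)
qed

text \<open>Compare Lebesgue measures after projecting to the line spanned by \<open>v\<close>.\<close>

lemma cover_connected_card_ge: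
  fixes F :: "'a::euclidean_space set set"
  assumes "finite F" and F: "\<forall>S\<in>F. bounded S \<and> diameter S \<le> \<epsilon>"
    and "connected K" "K \<subseteq> \<Union>F" "a \<in> K" "b \<in> K" and v: "norm v = 1" and "\<epsilon> > 0"
  shows "\<bar>(b - a) \<bullet> v\<bar> \<le> real (card F) * \<epsilon>"
proof -
  have wlog: "b \<bullet> v - a \<bullet> v \<le> real (card F) * \<epsilon>" if ab: "a \<in> K" "b \<in> K" "a \<bullet> v \<le> b \<bullet> v" for a b
  proof -
    \<comment> \<open>The projection of a set of diameter at most \<epsilon> fits into the interval
      of length \<epsilon> that starts at its infimum.\<close>
    define J where "J S = {Inf ((\<lambda>y. y \<bullet> v) ` S) .. Inf ((\<lambda>y. y \<bullet> v) ` S) + \<epsilon>}" for S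
    have J: "y \<bullet> v \<in> J S" if "S \<in> F" "y \<in> S" for S y
    proof -
      have S: "bounded S" "diameter S \<le> \<epsilon>" using F that by auto
      have bl: "bounded_linear (\<lambda>y. y \<bullet> v)" by (rule bounded_linear_inner_left)
      have bdd: "bdd_below ((\<lambda>y. y \<bullet> v) ` S)"
        by (rule bounded_imp_bdd_below[OF bounded_linear_image[OF S(1) bl]])
      have "y \<bullet> v - \<epsilon> \<le> z \<bullet> v" if "z \<in> S" for z
      proof -
        have "(y - z) \<bullet> v \<le> norm (y - z) * norm v" by (rule norm_cauchy_schwarz)
        also have "\<dots> = dist y z" using v by (simp add: dist_norm)
        also have "\<dots> \<le> \<epsilon>" using diameter_bounded_bound[OF S(1) \<open>y \<in> S\<close> that] S(2) by simp
        finally show ?thesis by (simp add: inner_diff_left)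
      qed
      then have "y \<bullet> v - \<epsilon> \<le> Inf ((\<lambda>y. y \<bullet> v) ` S)"
        using \<open>y \<in> S\<close> by (intro cInf_greatest) auto
      moreover have "Inf ((\<lambda>y. y \<bullet> v) ` S) \<le> y \<bullet> v"
        using bdd \<open>y \<in> S\<close> by (intro cInf_lower) auto
      ultimately show ?thesis by (auto simp: J_def)
    qed
    \<comment> \<open>By connectedness the projection of \<open>K\<close> fills the whole segment
      between the two projected points, so the intervals \<open>J S\<close> cover it and their total
      length bounds it.\<close>
    have "connected ((\<lambda>y. y \<bullet> v) ` K)"
      using \<open>connected K\<close> by (intro connected_continuous_image) (auto intro!: continuous_intros)
    then have "{a \<bullet> v..b \<bullet> v} \<subseteq> (\<lambda>y. y \<bullet> v) ` K"
      using ab by (intro connected_contains_Icc) auto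
    also have "\<dots> \<subseteq> (\<Union>S\<in>F. J S)" using J \<open>K \<subseteq> \<Union>F\<close> by blast
    finally have sub: "{a \<bullet> v..b \<bullet> v} \<subseteq> (\<Union>S\<in>F. J S)" .
    have bd: "bounded (\<Union>S\<in>F. J S)" using \<open>finite F\<close> by (auto simp: J_def)
    have "b \<bullet> v - a \<bullet> v = measure lborel {a \<bullet> v..b \<bullet> v}" using ab by simp
    also have "\<dots> \<le> measure lborel (\<Union>S\<in>F. J S)"
      using sub \<open>finite F\<close> bd
      by (intro measure_mono_fmeasurable fmeasurableI emeasure_bounded_finite)
         (auto simp: J_def intro!: borel_closed closed_UN)
    also have "\<dots> \<le> (\<Sum>S\<in>F. measure lborel (J S))"
      using \<open>finite F\<close> by (intro measure_UNION_le) (auto simp: J_def)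
    also have "\<dots> = real (card F) * \<epsilon>" using \<open>\<epsilon> > 0\<close> by (simp add: J_def)
    finally show ?thesis .
  qed
  show ?thesis
    using wlog[of a b] wlog[of b a] assms(5,6)
    by (cases "a \<bullet> v \<le> b \<bullet> v") (auto simp: inner_diff_left abs_if)
qed

text \<open>Two points of \<open>K\<close> at distance \<open>L\<close> force at least
  \<open>L / \<epsilon>\<close> covering sets, and the ratio of logarithms tends to 1. The
  surrounding Lipschitz curve guarantees that a finite cover realises the covering number.\<close>

lemma upper_box_dim_connected_ge:
  fixes g :: "real \<Rightarrow> 'a::euclidean_space"
  assumes lip: "C-lipschitz_on {0..d} g" and "d > 0" and E: "E \<subseteq> g ` {0..d}"
    and K: "connected K" "K \<subseteq> E" "a \<in> K" "b \<in> K" "a \<noteq> b"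
  shows "upper_box_dim E \<ge> 1"
proof -
  \<comment> \<open>Projecting along \<open>b - a\<close> itself loses none of the distance.\<close>
  define v where "v = sgn (b - a)"
  define L where "L = norm (b - a)"
  have L: "L > 0" and v: "norm v = 1" and Lv: "\<bar>(b - a) \<bullet> v\<bar> = L"
    using \<open>a \<noteq> b\<close>
    by (auto simp: L_def v_def norm_sgn sgn_div_norm power2_norm_eq_inner[symmetric] power2_eq_square)
  have "ereal 1 = Limsup (at_right 0) (\<lambda>\<epsilon>. ereal (ln (L / \<epsilon>) / ln (1 / \<epsilon>)))"
  proof (rule lim_imp_Limsup[symmetric])
    have "((\<lambda>\<epsilon>. ln (L / \<epsilon>) / ln (1 / \<epsilon>)) \<longlongrightarrow> 1) (at_right 0)"
      using L by real_asymp
    then show "((\<lambda>\<epsilon>. ereal (ln (L / \<epsilon>) / ln (1 / \<epsilon>))) \<longlongrightarrow> ereal 1) (at_right 0)"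
      by simp
  qed simp
  also have "\<dots> \<le> upper_box_dim E"
    unfolding upper_box_dim_def
  proof (rule Limsup_mono)
    show "\<forall>\<^sub>F \<epsilon> in at_right 0. ereal (ln (L / \<epsilon>) / ln (1 / \<epsilon>))
        \<le> ereal (ln (real (covering_number E \<epsilon>)) / ln (1 / \<epsilon>))"
      using eventually_at_right_less[of "0::real"] eventually_at_right_real[of 0 1, simplified]
    proof eventually_elim
      case (elim \<epsilon>)
      obtain F where F: "finite F" "card F = covering_number E \<epsilon>" "E \<subseteq> \<Union>F"
        "\<forall>S\<in>F. bounded S \<and> diameter S \<le> \<epsilon>"
        using covering_number_attained[OF lip \<open>d > 0\<close> elim(1) E] .
      have "L \<le> real (covering_number E \<epsilon>) * \<epsilon>"
        using cover_connected_card_ge[OF F(1,4) K(1) _ K(3,4) v elim(1)] F(2,3) K(2) Lv by auto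
      then have "L / \<epsilon> \<le> real (covering_number E \<epsilon>)" "L / \<epsilon> > 0"
        using elim L by (auto simp: field_simps)
      then have "ln (L / \<epsilon>) \<le> ln (real (covering_number E \<epsilon>))" by (intro ln_mono) auto
      moreover have "ln (1 / \<epsilon>) > 0" using elim by (simp add: ln_div)
      ultimately show ?case by (simp add: divide_right_mono)
    qed
  qed
  finally show ?thesis by (simp add: one_ereal_def)
qed

section \<open>Secants\<close>

text \<open>First-order expansion along \<open>X\<close>. The filter is arbitrary so that the result
  serves both sequences in a tangent cone and the one-sided limit in the definition of a
  probe.\<close>

lemma has_derivative_secant_limit:
  fixes f :: "'a::real_normed_vector \<Rightarrow> 'b::real_normed_vector"
  assumes f: "(f has_derivative f') (at x)" and X: "(X \<longlongrightarrow> x) F"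
    and l: "\<forall>\<^sub>F k in F. l k > 0" and v: "((\<lambda>k. (X k - x) /\<^sub>R l k) \<longlongrightarrow> v) F"
  shows "((\<lambda>k. (f (X k) - f x) /\<^sub>R l k) \<longlongrightarrow> f' v) F"
proof -
  interpret bounded_linear f' using f by (rule has_derivative_bounded_linear)
  \<comment> \<open>The normalised remainder. Division by zero gives \<open>R x = 0\<close>, so
    \<open>R\<close> is continuous at \<open>x\<close> and may be composed with \<open>X\<close>
    even where \<open>X k = x\<close>.\<close>
  define R where "R y = (f y - f x - f' (y - x)) /\<^sub>R norm (y - x)" for y
  have "(R \<longlongrightarrow> R x) (at x)"
    using f unfolding R_def has_derivative_at_within by (simp add: algebra_simps)
  then have "isCont R x" by (simp add: isCont_def)
  then have "((\<lambda>k. R (X k)) \<longlongrightarrow> 0) F"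
    using isCont_tendsto_compose[OF _ X, of R] by (simp add: R_def)
  moreover have "((\<lambda>k. f' ((X k - x) /\<^sub>R l k)) \<longlongrightarrow> f' v) F" using v by (rule tendsto)
  ultimately have "((\<lambda>k. norm ((X k - x) /\<^sub>R l k) *\<^sub>R R (X k) + f' ((X k - x) /\<^sub>R l k)) \<longlongrightarrow>
      norm v *\<^sub>R 0 + f' v) F"
    by (intro tendsto_intros v)
  moreover have "\<forall>\<^sub>F k in F. norm ((X k - x) /\<^sub>R l k) *\<^sub>R R (X k) + f' ((X k - x) /\<^sub>R l k) =
      (f (X k) - f x) /\<^sub>R l k"
    using l
  proof eventually_elim
    case (elim k)
    show ?case
    proof (cases "X k = x")
      case False
      then have "norm ((X k - x) /\<^sub>R l k) *\<^sub>R R (X k) = (f (X k) - f x - f' (X k - x)) /\<^sub>R l k"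
        using elim by (simp add: R_def)
      then show ?thesis by (simp add: scaleR scaleR_add_right[symmetric] del: scaleR_add_right)
    qed (simp add: zero)
  qed
  ultimately show ?thesis by (simp add: tendsto_cong)
qed

lemma has_vector_derivative_secant_limit:
  assumes c: "(c has_vector_derivative v) (at 0)"
    and l: "\<forall>\<^sub>F k in F. l k > 0" "(l \<longlongrightarrow> 0) F"
  shows "((\<lambda>k. (c (l k) - c 0) /\<^sub>R l k) \<longlongrightarrow> v) F"
proof -
  have "((\<lambda>k. (l k - 0) /\<^sub>R l k) \<longlongrightarrow> 1) F"
    using l(1) by (intro tendsto_eventually) (auto elim: eventually_mono)
  from has_derivative_secant_limit[OF c[unfolded has_vector_derivative_def] l(2,1) this]
  show ?thesis by simp
qed

section \<open>Directional contributions\<close>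

lemma theta_le_1: "theta x A v \<le> 1"
  unfolding theta_def
proof (rule SUP_least, clarify)
  fix g d assume "(g, d) \<in> probes x A v"
  then obtain C where g: "d > 0" "C-lipschitz_on {0..d} g" by (auto simp: probes_def)
  \<comment> \<open>Any single radius bounds the infimum from above; 1 is an arbitrary
    choice.\<close>
  have "(INF r\<in>{0<..}. upper_box_dim (A \<inter> g ` {0..d} \<inter> ball x r))
      \<le> upper_box_dim (A \<inter> g ` {0..d} \<inter> ball x 1)"
    by (rule INF_lower) simp
  also have "\<dots> \<le> 1" using g by (intro upper_box_dim_lipschitz_curve_le[of C d g]) auto
  finally show "dim_Pbox x (A \<inter> g ` {0..d}) \<le> 1" by (simp add: dim_Pbox_def)
qed

lemma thetaP_le_1: "thetaP x A \<xi> \<le> 1"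
  unfolding thetaP_def by (intro SUP_least theta_le_1)

text \<open>A curve in \<open>A\<close> with velocity \<open>v\<close>, restricted to a short
  interval \<open>{0..d}\<close>, is itself a probe for \<open>v\<close>. It never leaves
  \<open>A\<close>, so near \<open>x\<close> the set it meets contains a nondegenerate connected
  arc.\<close>

lemma theta_ge_1:
  assumes v: "v \<in> tangent_space x A" "norm v = 1"
  shows "theta x A v \<ge> 1"
proof -
  obtain e c where e: "e > 0" and c: "c C1_differentiable_on {-e<..<e}" "c ` {-e<..<e} \<subseteq> A"
    "c 0 = x" "(c has_vector_derivative v) (at 0)"
    using v(1) by (auto simp: tangent_space_def)
  obtain D where D: "\<And>t. t \<in> {-e<..<e} \<Longrightarrow> (c has_vector_derivative D t) (at t)"
    "continuous_on {-e<..<e} D"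
    using c(1) unfolding C1_differentiable_on_def by blast
  have D0: "D 0 = v"
    using D(1)[of 0] e c(4) vector_derivative_unique_at by (metis greaterThanLessThan_iff neg_less_0_iff_less)
  have "isCont D 0" using D(2) e by (simp add: continuous_on_eq_continuous_at)
  \<comment> \<open>Continuity of the derivative keeps \<open>D t\<close> at a positive inner
    product with \<open>v\<close> near 0; hence the component of \<open>c\<close> along
    \<open>v\<close> increases strictly and \<open>c\<close> is injective.\<close>
  then have "isCont (\<lambda>t. D t \<bullet> v) 0" by (intro continuous_intros)
  then have "((\<lambda>t. D t \<bullet> v) \<longlongrightarrow> 1) (at 0)"
    using v(2) D0 by (simp add: isCont_def norm_eq_1)
  then have "\<forall>\<^sub>F t in at 0. D t \<bullet> v > 0" by (rule order_tendstoD) simp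
  then obtain d0 where d0: "d0 > 0" "\<And>t. t \<noteq> 0 \<Longrightarrow> \<bar>t\<bar> < d0 \<Longrightarrow> D t \<bullet> v > 0"
    by (auto simp: eventually_at dist_real_def)
  \<comment> \<open>Halving places the compact interval \<open>{0..d}\<close> inside the open domain
    of the curve, so that \<open>D\<close> is bounded on it and yields the Lipschitz
    constant.\<close>
  define d where "d = min d0 e / 2"
  have d: "d > 0" "d < d0" "d < e" using d0(1) e by (auto simp: d_def)
  have Dpos: "D t \<bullet> v > 0" if "0 < t" "t \<le> d" for t using d0(2)[of t] that d by auto
  have contc: "continuous_on {0..d} c"
    using has_vector_derivative_continuous[OF D(1)] d e by (intro continuous_at_imp_continuous_on) auto
  have mono: "c s \<bullet> v < c t \<bullet> v" if st: "0 \<le> s" "s < t" "t \<le> d" for s t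
  proof (rule DERIV_pos_imp_increasing_open[OF st(2)])
    fix y assume y: "s < y" "y < t"
    have "((\<lambda>t. c t \<bullet> v) has_real_derivative D y \<bullet> v) (at y)"
      using bounded_linear.has_vector_derivative[OF bounded_linear_inner_left D(1)[of y], of v] y st d
      by (simp add: has_real_derivative_iff_has_vector_derivative)
    then show "\<exists>z. ((\<lambda>t. c t \<bullet> v) has_real_derivative z) (at y) \<and> 0 < z"
      using Dpos[of y] y st by auto
  next
    show "continuous_on {s..t} (\<lambda>t. c t \<bullet> v)"
      using st by (intro continuous_intros continuous_on_subset[OF contc]) auto
  qed
  have inj: "inj_on c {0..d}"
    by (rule inj_onI) (metis atLeastAtMost_iff linorder_neqE_linordered_idom mono order_less_irrefl)
  have "bounded (D ` {0..d})"
    using d by (intro compact_imp_bounded compact_continuous_image continuous_on_subset[OF D(2)]) auto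
  then obtain C where C: "C > 0" "\<And>t. t \<in> {0..d} \<Longrightarrow> norm (D t) \<le> C"
    unfolding bounded_pos by auto
  have lip: "C-lipschitz_on {0..d} c"
  proof (rule bounded_derivative_imp_lipschitz)
    fix t assume t: "t \<in> {0..d}"
    show "(c has_derivative (\<lambda>h. h *\<^sub>R D t)) (at t within {0..d})"
      using D(1)[of t] t d by (auto simp: has_vector_derivative_def intro: has_derivative_at_withinI)
    show "onorm (\<lambda>h. h *\<^sub>R D t) \<le> C"
      using C(2)[OF t] by (intro onorm_le) (simp add: mult.commute[of C] mult_left_mono)
  qed (use C in auto)
  have lim: "((\<lambda>t. (c t - x) /\<^sub>R norm (c t - x)) \<longlongrightarrow> v) (at_right 0)"
  proof -
    have "((\<lambda>t. (c t - x) /\<^sub>R t) \<longlongrightarrow> v) (at_right 0)"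
      using has_vector_derivative_secant_limit[OF c(4) eventually_at_right_less tendsto_ident_at] c(3)
      by simp
    \<comment> \<open>\<open>sgn\<close> is invariant under positive scaling, so dividing by
      \<open>t\<close> or by the norm gives the same unit secant.\<close>
    then have "((\<lambda>t. sgn ((c t - x) /\<^sub>R t)) \<longlongrightarrow> sgn v) (at_right 0)"
      by (intro tendsto_sgn) (use v in auto)
    moreover have "sgn v = v" using v(2) by (simp add: sgn_div_norm)
    moreover have "\<forall>\<^sub>F t in at_right 0. sgn ((c t - x) /\<^sub>R t) = (c t - x) /\<^sub>R norm (c t - x)"
      using eventually_at_right_less[of "0::real"]
      by eventually_elim (simp add: sgn_scaleR, simp add: sgn_div_norm)
    ultimately show ?thesis by (simp add: tendsto_cong)
  qed
  have sub: "c ` {0..d} \<subseteq> A" using c(2) d e by fastforce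
  have "A \<inter> c ` {0<..h} \<noteq> {}" if "h \<in> {0<..d}" for h
  proof -
    have "c h \<in> A \<inter> c ` {0<..h}" using sub that by auto
    then show ?thesis by blast
  qed
  then have probe: "(c, d) \<in> probes x A v"
    using d inj lip lim c(3) by (auto simp: probes_def)
  have E: "A \<inter> c ` {0..d} = c ` {0..d}" using sub by blast
  have "x \<in> c ` {0..d}" using c(3) d by (auto intro!: image_eqI[of _ _ 0])
  then have xcl: "x \<in> closure (c ` {0..d})" by (rule closure_subset[THEN subsetD])
  have "1 \<le> upper_box_dim (c ` {0..d} \<inter> ball x r)" if r: "r > 0" for r
  proof -
    \<comment> \<open>The Lipschitz bound gives \<open>C * s \<le> r / 2\<close>, so the arc up to
      \<open>s\<close> stays in the ball of radius \<open>r\<close>.\<close>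
    define s where "s = min d (r / (2 * C))"
    have s: "0 < s" "s \<le> d" "C * s < r" using d r C by (auto simp: s_def min_def field_simps)
    have K: "c ` {0..s} \<subseteq> c ` {0..d} \<inter> ball x r"
    proof -
      have "dist (c 0) (c t) < r" if "t \<in> {0..s}" for t
      proof -
        have "dist (c 0) (c t) \<le> C * dist 0 t" using lipschitz_onD[OF lip, of 0 t] that s d by auto
        also have "\<dots> \<le> C * s" using that C by (auto simp: dist_real_def)
        finally show ?thesis using s by simp
      qed
      then show ?thesis using s c(3) by auto
    qed
    have "connected (c ` {0..s})"
      using s by (intro connected_continuous_image continuous_on_subset[OF contc]) auto
    moreover have "c 0 \<noteq> c s" using mono[of 0 s] s by auto
    ultimately show ?thesis
      using s K by (intro upper_box_dim_connected_ge[OF lip d(1), where K = "c ` {0..s}" and a = "c 0" and b = "c s"]) auto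
  qed
  then have "1 \<le> dim_Pbox x (A \<inter> c ` {0..d})"
    unfolding E dim_Pbox_def using xcl by (auto intro!: INF_greatest)
  also have "\<dots> \<le> theta x A v"
    unfolding theta_def using SUP_upper[OF probe, of "\<lambda>(g, d). dim_Pbox x (A \<inter> g ` {0..d})"] by simp
  finally show ?thesis .
qed

section \<open>Point-Cross dimension as the dimension of the span of the effective
  directions\<close>

text \<open>Under the hypothesis each effective direction contributes exactly 1, so the supremum
  counts the largest independent family of effective directions.\<close>

lemma dim_cross_eq_dim_Eff:
  fixes A :: "'a::euclidean_space set"
  assumes "Eff x A \<subseteq> tangent_space x A"
  shows "dim_cross x A = ereal (real (dim (Eff x A)))"
  unfolding dim_cross_def
proof (rule Sup_eqI, clarify)
  fix m \<xi> assume m: "\<forall>i<m. \<xi> i \<in> EffP x A" "proj_independent m \<xi>"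
  obtain w where w: "\<forall>i<m. w i \<noteq> 0 \<and> span {w i} = \<xi> i" "inj_on w {..<m}" "independent (w ` {..<m})"
    using m(2) by (auto simp: proj_independent_def)
  have "w ` {..<m} \<subseteq> span (Eff x A)"
  proof clarify
    fix i assume "i < m"
    then obtain u where u: "u \<in> Eff x A" "\<xi> i = span {u}" using m(1) by (auto simp: EffP_def)
    have "w i \<in> span {w i}" by (simp add: span_base)
    then have "w i \<in> span {u}" using w(1) \<open>i < m\<close> u by auto
    then show "w i \<in> span (Eff x A)" using u(1) span_mono[of "{u}" "Eff x A"] by auto
  qed
  then have "card (w ` {..<m}) \<le> dim (span (Eff x A))"
    using independent_card_le_dim w(3) by blast
  then have "m \<le> dim (Eff x A)" using card_image[OF w(2)] by simp
  moreover have "(\<Sum>i<m. thetaP x A (\<xi> i)) \<le> (\<Sum>i<m. 1)"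
    by (intro sum_mono thetaP_le_1)
  ultimately show "(\<Sum>i<m. thetaP x A (\<xi> i)) \<le> ereal (real (dim (Eff x A)))"
    by (auto simp: one_ereal_def sum_ereal intro: order_trans)
next
  fix y :: ereal
  assume y: "\<And>z. z \<in> {(\<Sum>i<m. thetaP x A (\<xi> i)) | m \<xi>.
            m \<le> DIM('a) \<and> (\<forall>i<m. \<xi> i \<in> EffP x A) \<and> proj_independent m \<xi>} \<Longrightarrow> z \<le> y"
  \<comment> \<open>The basis is chosen among the effective directions themselves, so its elements
    are unit vectors and represent admissible projective points.\<close>
  obtain B where B: "B \<subseteq> Eff x A" "independent B" "card B = dim (Eff x A)"
    using basis_exists[of "Eff x A"] by metis
  have "finite B" using B(2) by (rule independent_imp_finite)
  define m where "m = dim (Eff x A)"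
  obtain w where w: "bij_betw w {..<m} B"
    using ex_bij_betw_nat_finite[OF \<open>finite B\<close>] B(3) by (auto simp: m_def atLeast0LessThan)
  have wE: "w i \<in> Eff x A" if "i < m" for i using w that B(1) by (auto simp: bij_betw_def)
  have w1: "norm (w i) = 1" if "i < m" for i
    using wE[OF that] by (auto simp: Eff_def split: if_splits)
  define \<xi> where "\<xi> i = span {w i}" for i
  have "(\<Sum>i<m. thetaP x A (\<xi> i)) \<le> y"
  proof (rule y, rule CollectI, intro exI conjI)
    show "m \<le> DIM('a)" unfolding m_def by (rule dim_subset_UNIV)
    show "\<forall>i<m. \<xi> i \<in> EffP x A" using wE by (auto simp: \<xi>_def EffP_def)
    have "\<forall>i<m. w i \<noteq> 0" using w1 by fastforce
    then show "proj_independent m \<xi>"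
      unfolding proj_independent_def using w B(2)
      by (intro exI[of _ w]) (auto simp: \<xi>_def bij_betw_def)
  qed simp
  moreover have "(\<Sum>i<m. 1) \<le> (\<Sum>i<m. thetaP x A (\<xi> i))"
  proof (rule sum_mono)
    fix i assume "i \<in> {..<m}"
    then have i: "i < m" by simp
    have "1 \<le> theta x A (w i)" using wE[OF i] w1[OF i] assms by (intro theta_ge_1) auto
    also have "\<dots> \<le> thetaP x A (\<xi> i)"
      unfolding thetaP_def using wE[OF i] by (intro SUP_upper) (auto simp: \<xi>_def)
    finally show "1 \<le> thetaP x A (\<xi> i)" .
  qed
  ultimately show "ereal (real (dim (Eff x A))) \<le> y"
    by (auto simp: one_ereal_def sum_ereal m_def intro: order_trans)
qed

section \<open>Tangent cones and tangent spaces\<close>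

lemma tangent_cone_mono: "A \<subseteq> B \<Longrightarrow> tangent_cone x A \<subseteq> tangent_cone x B"
  unfolding tangent_cone_def by blast

lemma tangent_space_mono: "A \<subseteq> B \<Longrightarrow> tangent_space x A \<subseteq> tangent_space x B"
  unfolding tangent_space_def by (blast intro: order_trans)

text \<open>One of the two sets contains infinitely many terms of the approximating sequence; the
  corresponding subsequence, with its scales, witnesses membership in the cone of that set.\<close>

lemma tangent_cone_Un: "tangent_cone x (A \<union> B) = tangent_cone x A \<union> tangent_cone x B"
proof
  show "tangent_cone x (A \<union> B) \<subseteq> tangent_cone x A \<union> tangent_cone x B"
  proof
    fix v assume "v \<in> tangent_cone x (A \<union> B)"
    then obtain X l where X: "\<forall>k::nat. X k \<in> A \<union> B" "X \<longlonglongrightarrow> x" and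
      l: "\<forall>k. l k > (0::real)" "decseq l" "l \<longlonglongrightarrow> 0" and lim: "(\<lambda>k. (X k - x) /\<^sub>R l k) \<longlonglongrightarrow> v"
      unfolding tangent_cone_def by blast
    have sub: "v \<in> tangent_cone x S" if inf: "infinite {k. X k \<in> S}" for S
    proof -
      obtain r :: "nat \<Rightarrow> nat" where r: "strict_mono r" "\<forall>n. X (r n) \<in> S"
        using infinite_enumerate[OF inf] by auto
      have "decseq (l \<circ> r)"
        by (simp add: decseq_def strict_mono_less_eq[OF r(1)] decseqD[OF l(2)])
      then show ?thesis
        unfolding tangent_cone_def
        using r l(1) LIMSEQ_subseq_LIMSEQ[OF X(2) r(1)] LIMSEQ_subseq_LIMSEQ[OF l(3) r(1)]
          LIMSEQ_subseq_LIMSEQ[OF lim r(1)]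
        by (intro CollectI exI[of _ "X \<circ> r"] exI[of _ "l \<circ> r"]) (auto simp: o_def)
    qed
    have "{k. X k \<in> A} \<union> {k. X k \<in> B} = UNIV" using X(1) by auto
    then have "infinite {k. X k \<in> A} \<or> infinite {k. X k \<in> B}"
      by (metis finite_Un infinite_UNIV_nat)
    then show "v \<in> tangent_cone x A \<union> tangent_cone x B" using sub by blast
  qed
qed (simp add: tangent_cone_mono)

lemma tangent_space_subset_tangent_cone: "tangent_space x A \<subseteq> tangent_cone x A"
proof
  fix v assume "v \<in> tangent_space x A"
  then obtain e c where e: "e > 0" and c: "c ` {-e<..<e} \<subseteq> A"
    "c 0 = x" "(c has_vector_derivative v) (at 0)"
    by (auto simp: tangent_space_def)
  \<comment> \<open>The shift by 2 keeps even \<open>l 0 = e / 2\<close> inside the open interval on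
    which the curve is defined.\<close>
  define l where "l k = e / (real k + 2)" for k
  have l: "l k > 0" "l k < e" for k using e by (auto simp: l_def field_simps intro: add_pos_nonneg)
  have "decseq l" using e by (auto simp: decseq_def l_def intro!: divide_left_mono)
  have l0: "l \<longlonglongrightarrow> 0" unfolding l_def by real_asymp
  have lim: "(\<lambda>k. (c (l k) - x) /\<^sub>R l k) \<longlonglongrightarrow> v"
    using has_vector_derivative_secant_limit[OF c(3) _ l0] l(1) c(2) by simp
  have "isCont c 0" using c(3) by (rule has_vector_derivative_continuous)
  then have "(\<lambda>k. c (l k)) \<longlonglongrightarrow> x" using isCont_tendsto_compose[OF _ l0] c(2) by auto
  moreover have "c (l k) \<in> A" for k using c(1) l[of k] by fastforce
  ultimately show "v \<in> tangent_cone x A"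
    unfolding tangent_cone_def using l \<open>decseq l\<close> l0 lim
    by (intro CollectI exI[of _ "\<lambda>k. c (l k)"] exI[of _ l]) auto
qed

section \<open>Tangent cones of submanifolds through slice charts\<close>

lemma C1_submanifold_tangent:
  fixes M :: "'a::euclidean_space set"
  assumes "C1_submanifold p M" "x \<in> M"
  shows "tangent_cone x M = tangent_space x M" "subspace (tangent_space x M)"
    "dim (tangent_space x M) = p"
proof -
  obtain U V \<phi> \<psi> L where xU: "x \<in> U" and diff: "C1_diffeomorphism U V \<phi> \<psi>"
    and L: "subspace L" "dim L = p" and slice: "\<phi> ` (M \<inter> U) = V \<inter> L"
    using assms unfolding C1_submanifold_def by metis
  have op: "open U" "open V" and hom: "homeomorphism U V \<phi> \<psi>"
    using diff by (auto simp: C1_diffeomorphism_def)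
  obtain \<phi>' where \<phi>': "\<And>y. y \<in> U \<Longrightarrow> (\<phi> has_derivative blinfun_apply (\<phi>' y)) (at y)"
    using diff by (auto simp: C1_diffeomorphism_def C1_map_on_def)
  obtain \<psi>' where \<psi>': "\<And>y. y \<in> V \<Longrightarrow> (\<psi> has_derivative blinfun_apply (\<psi>' y)) (at y)"
    "continuous_on V \<psi>'"
    using diff by (auto simp: C1_diffeomorphism_def C1_map_on_def)
  have inv: "\<And>y. y \<in> U \<Longrightarrow> \<psi> (\<phi> y) = y" "\<And>z. z \<in> V \<Longrightarrow> \<phi> (\<psi> z) = z"
    and maps: "\<And>y. y \<in> U \<Longrightarrow> \<phi> y \<in> V" "\<And>z. z \<in> V \<Longrightarrow> \<psi> z \<in> U"
    using hom by (auto simp: homeomorphism_def)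
  define P Q where "P = blinfun_apply (\<phi>' x)" and "Q = blinfun_apply (\<psi>' (\<phi> x))"
  have P: "(\<phi> has_derivative P) (at x)" and Q: "(\<psi> has_derivative Q) (at (\<phi> x))"
    using \<phi>' \<psi>' xU maps by (auto simp: P_def Q_def)
  have linQ: "linear Q" unfolding Q_def by (rule bounded_linear.linear[OF blinfun.bounded_linear_right])
  have QP: "Q (P v) = v" for v
  proof -
    have "((\<lambda>y. \<psi> (\<phi> y)) has_derivative (\<lambda>v. Q (P v))) (at x)"
      using diff_chain_at[OF P Q] by (simp add: o_def)
    moreover have "((\<lambda>y. \<psi> (\<phi> y)) has_derivative (\<lambda>v. v)) (at x)"
      using op(1) xU inv(1)
      by (intro has_derivative_transform_within_open[OF has_derivative_ident]) auto
    \<comment> \<open>The composite agrees with the identity on a neighbourhood of \<open>x\<close>,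
      and derivatives are unique.\<close>
    ultimately show ?thesis using fun_cong[OF has_derivative_unique, of _ _ _ _ v] by blast
  qed
  have "P (Q w) = w" for w
  proof -
    have "((\<lambda>z. \<phi> (\<psi> z)) has_derivative (\<lambda>w. P (Q w))) (at (\<phi> x))"
      using diff_chain_at[OF Q, of \<phi> P] P inv(1)[OF xU] by (simp add: o_def)
    moreover have "((\<lambda>z. \<phi> (\<psi> z)) has_derivative (\<lambda>w. w)) (at (\<phi> x))"
      using op(2) maps(1)[OF xU] inv(2)
      by (intro has_derivative_transform_within_open[OF has_derivative_ident]) auto
    ultimately show ?thesis using fun_cong[OF has_derivative_unique, of _ _ _ _ w] by blast
  qed
  then have injQ: "inj Q" by (metis injI)
  have xL: "\<phi> x \<in> L" using slice assms(2) xU by blast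
  have cone: "tangent_cone x M \<subseteq> Q ` L"
  proof
    fix v assume "v \<in> tangent_cone x M"
    then obtain X l where X: "\<forall>k::nat. X k \<in> M" "X \<longlonglongrightarrow> x" and
      l: "\<forall>k. l k > (0::real)" and lim: "(\<lambda>k. (X k - x) /\<^sub>R l k) \<longlonglongrightarrow> v"
      unfolding tangent_cone_def by blast
    have "\<forall>\<^sub>F k in sequentially. X k \<in> U" using X(2) op(1) xU by (rule topological_tendstoD)
    then have "\<forall>\<^sub>F k in sequentially. (\<phi> (X k) - \<phi> x) /\<^sub>R l k \<in> L"
    proof eventually_elim
      case (elim k)
      then have "\<phi> (X k) \<in> L" using X(1) slice by blast
      then show ?case using xL L(1) by (intro subspace_scale subspace_diff) auto
    qed
    \<comment> \<open>The chart carries secants of \<open>M\<close> to vectors of \<open>L\<close>;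
      as \<open>L\<close> is closed, the limit \<open>P v\<close> stays in it.\<close>
    moreover have "(\<lambda>k. (\<phi> (X k) - \<phi> x) /\<^sub>R l k) \<longlonglongrightarrow> P v"
      using has_derivative_secant_limit[OF P X(2) _ lim] l by simp
    ultimately have "P v \<in> L"
      by (rule Lim_in_closed_set[OF closed_subspace[OF L(1)] _ sequentially_bot])
    then show "v \<in> Q ` L" using QP[of v] by (metis imageI)
  qed
  have space: "Q ` L \<subseteq> tangent_space x M"
  proof clarify
    fix w assume w: "w \<in> L"
    \<comment> \<open>The line through the image of \<open>x\<close> in direction \<open>w\<close>
      stays in \<open>L\<close>, and in \<open>V\<close> for small parameters; pulled back by the
      inverse chart it is a curve in \<open>M\<close> with velocity \<open>Q w\<close>.\<close>
    define h where "h t = \<phi> x + t *\<^sub>R w" for t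
    have conth: "continuous_on S h" for S unfolding h_def by (intro continuous_intros)
    have "open (h -` V)" using op(2) conth[of UNIV] by (simp add: continuous_on_open_vimage)
    moreover have "0 \<in> h -` V" using maps(1)[OF xU] by (simp add: h_def)
    ultimately obtain e where e: "e > 0" "ball 0 e \<subseteq> h -` V" unfolding open_contains_ball by blast
    have hV: "h t \<in> V" if "t \<in> {-e<..<e}" for t using subsetD[OF e(2), of t] that by (simp add: dist_real_def abs_less_iff)
    have der: "((\<lambda>t. \<psi> (h t)) has_vector_derivative \<psi>' (h t) w) (at t)" if t: "t \<in> {-e<..<e}" for t
    proof -
      have "(h has_derivative (\<lambda>s. s *\<^sub>R w)) (at t)"
        unfolding h_def by (auto intro!: derivative_eq_intros)
      from diff_chain_at[OF this \<psi>'(1)[OF hV[OF t]]]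
      show ?thesis by (simp add: o_def has_vector_derivative_def blinfun.scaleR_right)
    qed
    have C1: "(\<lambda>t. \<psi> (h t)) C1_differentiable_on {-e<..<e}"
      unfolding C1_differentiable_on_def
    proof (intro exI[of _ "\<lambda>t. \<psi>' (h t) w"] conjI ballI der)
      have "continuous_on {-e<..<e} (\<lambda>t. \<psi>' (h t))"
        using hV by (intro continuous_on_compose2[OF \<psi>'(2) conth]) auto
      then show "continuous_on {-e<..<e} (\<lambda>t. \<psi>' (h t) w)" by (intro continuous_intros)
    qed
    have "\<psi> (h t) \<in> M" if "t \<in> {-e<..<e}" for t
    proof -
      have "h t \<in> L" using w xL L(1) by (auto simp: h_def intro!: subspace_add subspace_scale)
      then have "h t \<in> \<phi> ` (M \<inter> U)" using hV[OF that] slice by blast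
      then show ?thesis using inv(1) by auto
    qed
    moreover have "h 0 = \<phi> x" by (simp add: h_def)
    ultimately show "Q w \<in> tangent_space x M"
      unfolding tangent_space_def
      using e(1) C1 der[of 0] inv(1)[OF xU]
      by (intro CollectI exI[of _ e] conjI exI[of _ "\<lambda>t. \<psi> (h t)"]) (auto simp: Q_def)
  qed
  have eq: "tangent_space x M = Q ` L"
    using cone space tangent_space_subset_tangent_cone[of x M] by blast
  show "tangent_cone x M = tangent_space x M"
    using cone space tangent_space_subset_tangent_cone[of x M] by blast
  show "subspace (tangent_space x M)"
    unfolding eq using linQ L(1) by (rule linear_subspace_image)
  show "dim (tangent_space x M) = p"
    unfolding eq using dim_image_eq[OF linQ] injQ L(2) by (metis inj_on_subset subset_UNIV)
qed

section \<open>From tangent cones to the dimension formulas\<close>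

text \<open>Normalising vectors shows that both sets have the same span. Only closure under scaling
  is assumed, because the lemma is applied to a union of two tangent spaces, which need not be a
  subspace.\<close>

lemma dim_Int_sphere:
  fixes T :: "'a::euclidean_space set"
  assumes "\<And>v r. v \<in> T \<Longrightarrow> r *\<^sub>R v \<in> T"
  shows "dim (T \<inter> sphere 0 1) = dim T"
proof -
  have "T \<subseteq> span (T \<inter> sphere 0 1)"
  proof
    fix v assume v: "v \<in> T"
    show "v \<in> span (T \<inter> sphere 0 1)"
    proof (cases "v = 0")
      case False
      then have "v /\<^sub>R norm v \<in> T \<inter> sphere 0 1" using assms[OF v] by simp
      then have "norm v *\<^sub>R (v /\<^sub>R norm v) \<in> span (T \<inter> sphere 0 1)"
        by (intro span_scale span_base)
      then show ?thesis using False by simp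
    qed (simp add: span_zero)
  qed
  then have "span T = span (T \<inter> sphere 0 1)"
    by (intro span_eq[THEN iffD2]) (auto intro: span_base)
  then show ?thesis by (metis dim_span)
qed

lemma dim_cross_eq_dim_tangent:
  fixes A :: "'a::euclidean_space set"
  assumes "x \<in> A" "tangent_cone x A = T" "T \<subseteq> tangent_space x A"
    and "\<And>v r. v \<in> T \<Longrightarrow> r *\<^sub>R v \<in> T"
  shows "dim_cross x A = ereal (real (dim T))"
proof -
  have "Eff x A = T \<inter> sphere 0 1"
    using assms(1,2) closure_subset by (auto simp: Eff_def)
  then show ?thesis
    using dim_cross_eq_dim_Eff[of x A] dim_Int_sphere[of T] assms(3,4) by auto
qed

theorem theorem4p19:
  fixes M N :: "'a::euclidean_space set" and x :: 'a and p q :: nat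
  assumes "C1_submanifold p M" and "C1_submanifold q N"
    and "x \<in> M" and "x \<in> N"
    and "\<exists>W r. open W \<and> x \<in> W \<and> C1_submanifold r (M \<inter> N \<inter> W)"
    and "tangent_space x (M \<inter> N) = tangent_space x M \<inter> tangent_space x N"
  shows "dim_cross x (M \<union> N) = ereal (real (dim (tangent_space x M + tangent_space x N))) \<and>
    dim_cross x (M \<inter> N) = ereal (real (dim (tangent_space x M \<inter> tangent_space x N))) \<and>
    dim_cross x (M \<union> N) + dim_cross x (M \<inter> N) = ereal (real p + real q) \<and>
    (tangent_space x M + tangent_space x N = UNIV \<longrightarrow>
       dim_cross x (M \<union> N) = ereal (real DIM('a)) \<and>
       dim_cross x (M \<inter> N) = ereal (real p + real q - real DIM('a))) \<and>
    (tangent_space x M \<inter> tangent_space x N = {0} \<longrightarrow>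
       dim_cross x (M \<union> N) = ereal (real p + real q) \<and>
       dim_cross x (M \<inter> N) = 0)"
proof -
  let ?S = "tangent_space x M" and ?T = "tangent_space x N"
  note M = C1_submanifold_tangent[OF assms(1,3)] and N = C1_submanifold_tangent[OF assms(2,4)]
  have "dim_cross x (M \<union> N) = ereal (real (dim (?S \<union> ?T)))"
  proof (rule dim_cross_eq_dim_tangent)
    show "tangent_cone x (M \<union> N) = ?S \<union> ?T" by (simp add: tangent_cone_Un M N)
    show "?S \<union> ?T \<subseteq> tangent_space x (M \<union> N)" by (simp add: tangent_space_mono)
  qed (use assms(3) M(2) N(2) in \<open>auto intro: subspace_scale\<close>)
  moreover have plus: "?S + ?T = {a + b |a b. a \<in> ?S \<and> b \<in> ?T}"
    by (auto simp: set_plus_def)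
  \<comment> \<open>The union of two subspaces spans their sum.\<close>
  have "dim (?S + ?T) = dim (?S \<union> ?T)"
  proof -
    have "span (?S \<union> ?T) = ?S + ?T"
      unfolding span_Un plus using M(2) N(2) by (simp add: span_eq_iff[THEN iffD2])
    then show ?thesis by (metis dim_span)
  qed
  ultimately have U: "dim_cross x (M \<union> N) = ereal (real (dim (?S + ?T)))" by simp
  have I: "dim_cross x (M \<inter> N) = ereal (real (dim (?S \<inter> ?T)))"
  proof (rule dim_cross_eq_dim_tangent)
    \<comment> \<open>The cone of the intersection lies in both tangent spaces and contains the
      tangent space of the intersection; cleanness makes the two bounds coincide.\<close>
    show "tangent_cone x (M \<inter> N) = ?S \<inter> ?T"
      using tangent_cone_mono[of "M \<inter> N" M x] tangent_cone_mono[of "M \<inter> N" N x] M(1) N(1)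
        tangent_space_subset_tangent_cone[of x "M \<inter> N"] assms(6) by auto
  qed (use assms(3,4,6) M(2) N(2) in \<open>auto intro: subspace_scale\<close>)
  \<comment> \<open>The dimension formula for subspaces; the additive identity and both special
    cases follow from it.\<close>
  have sum: "dim (?S + ?T) + dim (?S \<inter> ?T) = p + q"
    using dim_sums_Int[OF M(2) N(2)] M(3) N(3) by (simp add: plus)
  then have rsum: "real (dim (?S + ?T)) + real (dim (?S \<inter> ?T)) = real p + real q"
    by (metis of_nat_add)
  show ?thesis
  proof (intro conjI impI)
    show "dim_cross x (M \<union> N) = ereal (real (dim (?S + ?T)))" by (fact U)
    show "dim_cross x (M \<inter> N) = ereal (real (dim (?S \<inter> ?T)))" by (fact I)
    show "dim_cross x (M \<union> N) + dim_cross x (M \<inter> N) = ereal (real p + real q)"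
      unfolding U I plus_ereal.simps rsum ..
  next
    assume "?S + ?T = UNIV"
    then have d: "dim (?S + ?T) = DIM('a)" by (simp only: dim_UNIV)
    show "dim_cross x (M \<union> N) = ereal (real DIM('a))" unfolding U d ..
    show "dim_cross x (M \<inter> N) = ereal (real p + real q - real DIM('a))"
      unfolding I rsum[symmetric] d by simp
  next
    assume "?S \<inter> ?T = {0}"
    then have d: "dim (?S \<inter> ?T) = 0" by simp
    show "dim_cross x (M \<union> N) = ereal (real p + real q)"
      unfolding U rsum[symmetric] d by simp
    show "dim_cross x (M \<inter> N) = 0" unfolding I d by simp
  qed
qed

end
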